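(* Let $u,v,t$ be integers with $t>0$ and $(u-1)(v-2)=2t^2$. Then $(u,v,P,\mathbb{Q})$ is true if and only if there exists a positive integer $m$ such that $$t=\frac{(3+2\sqrt{2})^m-(3-2\sqrt{2})^m}{4\sqrt{2}}.$$
   Context: For integers $u,v$, the phrase "$(u,v,P,\mathbb{Q})$ is true" means: there exist $a,b\in\mathbb{Q}$ with $a\neq 0$ such that the polynomial $P(x,y)=axy+bx+by+\frac{b^2-b}{a}\in\mathbb{Q}[x,y]$, which defines a commutative group operation $x\oplus y=P(x,y)$ on the set $\mathbb{Q}\setminus\{-b/a\}$, satisfies $1\oplus 1=u$ and $2\oplus 2=v$, i.e. $P(1,1)=u$ and $P(2,2)=v$. (The conditions are on the values of the polynomial; it is not required that $1$ and $2$ differ from $-b/a$.) *)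

theory Defs
  imports Complex_Main "HOL-Algebra.Group"
begin

definition P :: "rat \<Rightarrow> rat \<Rightarrow> rat \<Rightarrow> rat \<Rightarrow> rat"
  where "P a b x y = a * x * y + b * x + b * y + (b^2 - b) / a"

definition P_group :: "rat \<Rightarrow> rat \<Rightarrow> rat monoid"
  where "P_group a b = \<lparr>carrier = UNIV - {- b / a}, monoid.mult = P a b, one = (1 - b) / a\<rparr>"

(* For a \<noteq> 0 the map x \<mapsto> a * x + b carries P a b to multiplication of rationals,
   and the excluded point - b / a to 0. *)
lemma P_affine:
  assumes "a \<noteq> 0"
  shows "a * P a b x y + b = (a * x + b) * (a * y + b)"
  using assms by (simp add: P_def field_simps power2_eq_square)

lemma carrier_P_group_iff:
  assumes "a \<noteq> 0"
  shows "x \<in> carrier (P_group a b) \<longleftrightarrow> a * x + b \<noteq> 0"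
  using assms by (auto simp: P_group_def field_simps eq_neg_iff_add_eq_0)

theorem comm_group_P_group:
  assumes a: "a \<noteq> 0"
  shows "comm_group (P_group a b)"
proof (rule comm_groupI)
  have inj: "x = y" if "a * x + b = a * y + b" for x y :: rat
    using that a by simp
  note carr = carrier_P_group_iff[OF a]
  fix x y z
  assume x: "x \<in> carrier (P_group a b)" and y: "y \<in> carrier (P_group a b)"
  show "x \<otimes>\<^bsub>P_group a b\<^esub> y \<in> carrier (P_group a b)"
    using x y unfolding carr by (simp add: P_group_def P_affine[OF a])
  show "x \<otimes>\<^bsub>P_group a b\<^esub> y \<otimes>\<^bsub>P_group a b\<^esub> z = x \<otimes>\<^bsub>P_group a b\<^esub> (y \<otimes>\<^bsub>P_group a b\<^esub> z)"
    by (rule inj) (simp add: P_group_def P_affine[OF a])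
  show "x \<otimes>\<^bsub>P_group a b\<^esub> y = y \<otimes>\<^bsub>P_group a b\<^esub> x"
    by (simp add: P_group_def P_def algebra_simps)
  show "\<one>\<^bsub>P_group a b\<^esub> \<otimes>\<^bsub>P_group a b\<^esub> x = x"
    by (rule inj) (simp add: P_group_def P_affine[OF a] a)
  show "\<exists>w\<in>carrier (P_group a b). w \<otimes>\<^bsub>P_group a b\<^esub> x = \<one>\<^bsub>P_group a b\<^esub>"
  proof
    let ?w = "(1 / (a * x + b) - b) / a"
    have nz: "a * x + b \<noteq> 0" using x by (simp add: carr)
    have w: "a * ?w + b = 1 / (a * x + b)" using a by simp
    show "?w \<in> carrier (P_group a b)"
      unfolding carr w using nz by simp
    have "a * P a b ?w x + b = a * ((1 - b) / a) + b"
      unfolding P_affine[OF a] w using nz a by simp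
    then have "P a b ?w x = (1 - b) / a"
      by (rule inj)
    then show "?w \<otimes>\<^bsub>P_group a b\<^esub> x = \<one>\<^bsub>P_group a b\<^esub>"
      by (simp add: P_group_def)
  qed
next
  show "\<one>\<^bsub>P_group a b\<^esub> \<in> carrier (P_group a b)"
    unfolding carrier_P_group_iff[OF a] using a by (simp add: P_group_def)
qed

(* The conditions are on the values of the polynomial P a b: neither 1 nor 2
   is required to lie in the carrier of P_group a b. *)
definition is_true :: "int \<Rightarrow> int \<Rightarrow> bool"
  where "is_true u v \<longleftrightarrow>
    (\<exists>a b :: rat. a \<noteq> 0 \<and> P a b 1 1 = of_int u \<and> P a b 2 2 = of_int v)"

end

theory Submission
  imports Defs
begin

text \<open>
  Write \<open>U = u - 1\<close> and \<open>V = v - 2\<close>. In the affine coordinate \<open>x \<mapsto> a x + b\<close> the operation is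
  multiplication, so the equation \<open>x \<oplus> x = y\<close> says that the coordinates \<open>r\<close> of \<open>x\<close> and \<open>r\<^sup>2\<close> of \<open>y\<close>
  differ by \<open>a (y - x)\<close>. For the consecutive points 1 and 2, with coordinates \<open>s\<close> and \<open>s + a\<close>, this
  gives \<open>s\<^sup>2 - s = a U\<close> and \<open>(s + a)\<^sup>2 - (s + a) = a V\<close>. Subtracting and cancelling \<open>a\<close> makes \<open>a\<close>
  linear in \<open>s\<close>, and substituting back leaves a monic quadratic equation for \<open>s\<close> with
  discriminant \<open>1 + 4 U V\<close>; a rational solution exists exactly when this is a square
  (\<open>doubling_pair_solvable_iff\<close>).

  If \<open>U V = 2 t\<^sup>2\<close>, the discriminant is the integer \<open>8 t\<^sup>2 + 1\<close>, whose rational square roots are integers.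
  So the question is whether \<open>t\<close> belongs to a solution of the Pell equation \<open>w\<^sup>2 = 8 t\<^sup>2 + 1\<close>.
  The positive units \<open>w + 2 t \<surd>2\<close> of norm 1 with \<open>t \<ge> 0\<close> are the powers of the smallest one, \<open>3 + 2 \<surd>2\<close>:
  dividing by it sends a solution with \<open>t > 0\<close> to one with smaller \<open>t\<close>, ending at the unit 1
  (\<open>pell_solution_is_unit_power\<close>). Subtracting conjugates in \<open>w + 2 t \<surd>2 = (3 + 2 \<surd>2)\<^sup>m\<close> isolates \<open>t\<close>.
\<close>

text \<open>The relation \<open>x \<oplus> x = y\<close> read in the coordinate in which \<open>\<oplus>\<close> is multiplication.\<close>

lemma P_diagonal_eq_iff:
  assumes "a \<noteq> 0"
  shows "P a b x x = y \<longleftrightarrow> (a * x + b)^2 - (a * x + b) = a * (y - x)"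
proof -
  have "P a b x x = y \<longleftrightarrow> a * P a b x x + b = a * y + b"
    using assms by simp
  also have "\<dots> \<longleftrightarrow> (a * x + b)^2 - (a * x + b) = a * (y - x)"
    unfolding P_affine[OF assms] by (auto simp: power2_eq_square algebra_simps)
  finally show ?thesis .
qed

text \<open>
  Eliminating \<open>a\<close> leaves a quadratic equation for \<open>s\<close>, and \<open>w\<close> is a square root of its
  discriminant. The two roots give \<open>a = U + V - w\<close> and \<open>a = U + V + w\<close>; since \<open>w \<noteq> 0\<close>, these cannot
  both vanish, which is how \<open>a \<noteq> 0\<close> is arranged.
\<close>

lemma doubling_pair_solvable_iff:
  fixes U V :: "'a :: field_char_0"
  assumes disc: "1 + 4 * U * V \<noteq> 0"
  shows "(\<exists>a s. a \<noteq> 0 \<and> s^2 - s = a * U \<and> (s + a)^2 - (s + a) = a * V)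
    \<longleftrightarrow> (\<exists>w. w^2 = 1 + 4 * U * V)"
proof
  assume "\<exists>a s. a \<noteq> 0 \<and> s^2 - s = a * U \<and> (s + a)^2 - (s + a) = a * V"
  then obtain a s where a: "a \<noteq> 0" and U: "s^2 - s = a * U"
    and V: "(s + a)^2 - (s + a) = a * V"
    by blast
  have "a * (2 * s + a - 1) = a * (V - U)"
    using U V by (simp add: power2_eq_square algebra_simps)
  with a have "2 * s + a - 1 = V - U"
    by simp
  then have a_eq: "a = V - U + 1 - 2 * s"
    by (simp add: algebra_simps)
  have "(2 * s + 2 * U - 1)^2 = 1 + 4 * U * V"
    using U unfolding a_eq by algebra
  then show "\<exists>w. w^2 = 1 + 4 * U * V" ..
next
  assume "\<exists>w. w^2 = 1 + 4 * U * V"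
  then obtain w0 where w0: "w0^2 = 1 + 4 * U * V" ..
  then have "w0 \<noteq> 0"
    using disc by auto
  moreover have "(U + V - (- w0)) - (U + V - w0) = 2 * w0"
    by simp
  ultimately have "U + V - w0 \<noteq> 0 \<or> U + V - (- w0) \<noteq> 0"
    by auto
  then obtain w where w: "w^2 = 1 + 4 * U * V" and nz: "U + V - w \<noteq> 0"
    using w0 by (metis power2_minus)
  define s where "s = (w + 1) / 2 - U"
  have two_s: "2 * s = w + 1 - 2 * U"
    by (simp add: s_def right_diff_distrib)
  have "4 * (s^2 - s) = 4 * ((U + V - w) * U)"
    using w two_s by algebra
  moreover have "4 * ((s + (U + V - w))^2 - (s + (U + V - w))) = 4 * ((U + V - w) * V)"
    using w two_s by algebra
  ultimately show "\<exists>a s. a \<noteq> 0 \<and> s^2 - s = a * U \<and> (s + a)^2 - (s + a) = a * V"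
    using nz by (metis mult_cancel_left zero_neq_numeral)
qed

lemma rat_square_of_int_iff:
  fixes n :: int
  shows "(\<exists>w::rat. w^2 = of_int n) \<longleftrightarrow> (\<exists>k. k^2 = n)"
proof
  assume "\<exists>w::rat. w^2 = of_int n"
  then obtain w :: rat where w2: "w^2 = of_int n" ..
  obtain p q where pq: "quotient_of w = (p, q)"
    by fastforce
  have q: "q > 0" and cop: "coprime p q" and w: "w = of_int p / of_int q"
    using pq by (auto simp: quotient_of_denom_pos quotient_of_coprime quotient_of_div)
  have "of_int (p^2) = (of_int (n * q^2) :: rat)"
    using w2 q by (simp add: w power_divide field_simps)
  then have "p^2 = n * q^2"
    by (simp only: of_int_eq_iff)
  then have "q dvd p"
    by (metis dvd_triv_right pow_divides_pow_iff zero_less_numeral)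
  with cop q have "q = 1"
    by (metis abs_of_pos coprime_absorb_right zdvd1_eq)
  with w w2 have "of_int (p^2) = (of_int n :: rat)"
    by simp
  then have "p^2 = n"
    by (simp only: of_int_eq_iff)
  then show "\<exists>k. k^2 = n" ..
next
  assume "\<exists>k. k^2 = n"
  then obtain k where "k^2 = n" ..
  then have "(of_int k :: rat)^2 = of_int n"
    by auto
  then show "\<exists>w::rat. w^2 = of_int n" ..
qed

lemma is_true_iff_discriminant_square:
  assumes "(u - 1) * (v - 2) \<ge> 0"
  shows "is_true u v \<longleftrightarrow> (\<exists>w. w^2 = 1 + 4 * ((u - 1) * (v - 2)))"
proof -
  define U V :: rat where "U = of_int (u - 1)" and "V = of_int (v - 2)"
  have UV: "1 + 4 * U * V = of_int (1 + 4 * ((u - 1) * (v - 2)))"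
    by (simp add: U_def V_def)
  have disc: "1 + 4 * U * V \<noteq> 0"
    using assms unfolding UV of_int_eq_0_iff by linarith
  \<comment> \<open>\<open>s = a + b\<close> is the coordinate of the point 1, and \<open>s + a\<close> that of the point 2.\<close>
  have shift: "(\<exists>b. F (a + b)) \<longleftrightarrow> (\<exists>s. F s)" for F and a :: rat
    by (metis add.commute diff_add_cancel)
  have "is_true u v \<longleftrightarrow>
      (\<exists>a b. a \<noteq> 0 \<and> (a + b)^2 - (a + b) = a * U \<and> ((a + b) + a)^2 - ((a + b) + a) = a * V)"
    unfolding is_true_def
    by (intro ex_cong1 conj_cong refl)
      (simp_all add: P_diagonal_eq_iff U_def V_def algebra_simps)
  also have "\<dots> \<longleftrightarrow> (\<exists>a s. a \<noteq> 0 \<and> s^2 - s = a * U \<and> (s + a)^2 - (s + a) = a * V)"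
    by (rule ex_cong1)
      (rule shift[where F = "\<lambda>s. _ \<noteq> 0 \<and> s^2 - s = _ * U \<and> (s + _)^2 - (s + _) = _ * V"])
  also have "\<dots> \<longleftrightarrow> (\<exists>w. w^2 = 1 + 4 * U * V)"
    by (rule doubling_pair_solvable_iff[OF disc])
  also have "\<dots> \<longleftrightarrow> (\<exists>w. w^2 = 1 + 4 * ((u - 1) * (v - 2)))"
    unfolding UV by (rule rat_square_of_int_iff)
  finally show ?thesis .
qed

text \<open>
  Dividing \<open>w + 2 t \<surd>2\<close> by \<open>3 + 2 \<surd>2\<close>, that is, multiplying by the conjugate \<open>3 - 2 \<surd>2\<close>, gives the
  unit with coordinates \<open>3 w - 8 t\<close> and \<open>3 t - w\<close>. The equation forces \<open>2 t < w \<le> 3 t\<close> if \<open>t > 0\<close>, so the new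
  second coordinate lies in \<open>{0..<t}\<close>.
\<close>

lemma pell_solution_is_unit_power:
  fixes w t :: int
  assumes "w^2 = 8 * t^2 + 1" "w > 0" "t \<ge> 0"
  shows "\<exists>m. of_int w + of_int t * (2 * sqrt 2) = (3 + 2 * sqrt 2) ^ m"
  using assms
proof (induction "nat t" arbitrary: w t rule: less_induct)
  case less
  show ?case
  proof (cases "t = 0")
    case True
    with less.prems have "w = 1"
      by (simp add: power2_eq_1_iff)
    with True have "of_int w + of_int t * (2 * sqrt 2) = (3 + 2 * sqrt 2) ^ 0"
      by simp
    then show ?thesis ..
  next
    case False
    with less.prems have t: "t > 0" by simp
    then have t2: "t^2 \<ge> 1"
      by (simp add: int_one_le_iff_zero_less)
    have "(2 * t)^2 < w^2"
      using less.prems(1) t2 by (simp add: power_mult_distrib)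
    then have lower: "2 * t < w"
      using less.prems(2) by (meson less_imp_le power_less_imp_less_base)
    have "w^2 \<le> (3 * t)^2"
      using less.prems(1) t2 by (simp add: power_mult_distrib)
    then have upper: "w \<le> 3 * t"
      by (rule power2_le_imp_le) (use t in simp)
    have "(8 * t)^2 < (3 * w)^2"
      using less.prems(1) t2 by (simp add: power_mult_distrib)
    then have pos: "8 * t < 3 * w"
      by (rule power_less_imp_less_base) (use less.prems(2) in simp)
    have "(3 * w - 8 * t)^2 = 8 * (3 * t - w)^2 + 1"
      using less.prems(1) by algebra
    moreover have "nat (3 * t - w) < nat t"
      using lower upper t by linarith
    ultimately obtain m where
      "of_int (3 * w - 8 * t) + of_int (3 * t - w) * (2 * sqrt 2) = (3 + 2 * sqrt 2) ^ m"
      using less.hyps[of "3 * t - w" "3 * w - 8 * t"] pos upper by auto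
    then have "(3 + 2 * sqrt 2) ^ Suc m =
        (3 + 2 * sqrt 2) * (of_int (3 * w - 8 * t) + of_int (3 * t - w) * (2 * sqrt 2))"
      by simp
    also have "\<dots> = of_int w + of_int t * (2 * sqrt 2)"
      by (simp add: algebra_simps)
    finally show ?thesis
      by metis
  qed
qed

text \<open>
  The two powers have the same integer coefficients because conjugation is multiplicative. So their
  difference determines the coefficient \<open>t\<close>, while their product, the norm, yields the Pell equation.
\<close>

lemma unit_power_conjugates:
  "\<exists>w t :: int. (3 + 2 * sqrt 2) ^ m = of_int w + of_int t * (2 * sqrt 2) \<and>
    (3 - 2 * sqrt 2) ^ m = of_int w - of_int t * (2 * sqrt 2)"
proof (induction m)
  case 0
  have "(3 + 2 * sqrt 2) ^ 0 = of_int 1 + of_int 0 * (2 * sqrt 2)"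
    "(3 - 2 * sqrt 2) ^ 0 = of_int 1 - of_int 0 * (2 * sqrt 2)"
    by simp_all
  then show ?case by blast
next
  case (Suc m)
  then obtain w t :: int where IH:
    "(3 + 2 * sqrt 2) ^ m = of_int w + of_int t * (2 * sqrt 2)"
    "(3 - 2 * sqrt 2) ^ m = of_int w - of_int t * (2 * sqrt 2)"
    by blast
  have "(3 + 2 * sqrt 2) ^ Suc m = of_int (3 * w + 8 * t) + of_int (w + 3 * t) * (2 * sqrt 2)"
    "(3 - 2 * sqrt 2) ^ Suc m = of_int (3 * w + 8 * t) - of_int (w + 3 * t) * (2 * sqrt 2)"
    unfolding power_Suc IH by (simp_all add: algebra_simps)
  then show ?case by blast
qed

lemma unit_conjugates_power_mult: "(3 + 2 * sqrt 2) ^ m * (3 - 2 * sqrt 2) ^ m = 1"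
  by (simp add: power_mult_distrib[symmetric] algebra_simps)

lemma conjugates_mult_eq_norm: "(x + y * (2 * sqrt 2)) * (x - y * (2 * sqrt 2)) = x^2 - 8 * y^2"
  by (simp add: power2_eq_square algebra_simps)

lemma pell_solvable_iff_power:
  fixes t :: int
  assumes "t > 0"
  shows "(\<exists>w. w^2 = 8 * t^2 + 1) \<longleftrightarrow>
    (\<exists>m::nat. m > 0 \<and>
      real_of_int t = ((3 + 2 * sqrt 2) ^ m - (3 - 2 * sqrt 2) ^ m) / (4 * sqrt 2))"
proof
  assume "\<exists>w. w^2 = 8 * t^2 + 1"
  then obtain w0 where "w0^2 = 8 * t^2 + 1" ..
  define w where "w = \<bar>w0\<bar>"
  have w: "w^2 = 8 * t^2 + 1"
    using \<open>w0^2 = 8 * t^2 + 1\<close> by (simp add: w_def)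
  have "8 * t^2 + 1 > 0"
    using zero_le_power2[of t] by linarith
  then have "w > 0"
    unfolding w[symmetric] by (simp add: w_def)
  obtain m where m: "of_int w + of_int t * (2 * sqrt 2) = (3 + 2 * sqrt 2) ^ m"
    using pell_solution_is_unit_power[of w t] w \<open>w > 0\<close> assms by auto
  have "real_of_int (w^2) = of_int (8 * t^2 + 1)"
    using w by (simp only:)
  then have "(3 + 2 * sqrt 2) ^ m * (of_int w - of_int t * (2 * sqrt 2)) = 1"
    unfolding m[symmetric] conjugates_mult_eq_norm by simp
  also have "\<dots> = (3 + 2 * sqrt 2) ^ m * (3 - 2 * sqrt 2) ^ m"
    by (simp add: unit_conjugates_power_mult)
  finally have m': "of_int w - of_int t * (2 * sqrt 2) = (3 - 2 * sqrt 2) ^ m"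
    using unit_conjugates_power_mult[of m]
    by (metis mult_cancel_left mult_zero_left zero_neq_one)
  have eq: "real_of_int t = ((3 + 2 * sqrt 2) ^ m - (3 - 2 * sqrt 2) ^ m) / (4 * sqrt 2)"
    unfolding m[symmetric] m'[symmetric] by simp
  have "m > 0"
    using eq assms by (cases m) auto
  with eq show "\<exists>m::nat. m > 0 \<and>
      real_of_int t = ((3 + 2 * sqrt 2) ^ m - (3 - 2 * sqrt 2) ^ m) / (4 * sqrt 2)"
    by blast
next
  assume "\<exists>m::nat. m > 0 \<and>
      real_of_int t = ((3 + 2 * sqrt 2) ^ m - (3 - 2 * sqrt 2) ^ m) / (4 * sqrt 2)"
  then obtain m :: nat where
    t: "real_of_int t = ((3 + 2 * sqrt 2) ^ m - (3 - 2 * sqrt 2) ^ m) / (4 * sqrt 2)"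
    by blast
  obtain w t' :: int where m: "(3 + 2 * sqrt 2) ^ m = of_int w + of_int t' * (2 * sqrt 2)"
    "(3 - 2 * sqrt 2) ^ m = of_int w - of_int t' * (2 * sqrt 2)"
    using unit_power_conjugates by blast
  have "t = t'"
    using t unfolding m by simp
  with unit_conjugates_power_mult[of m] have "real_of_int (w^2) = of_int (8 * t^2 + 1)"
    unfolding m conjugates_mult_eq_norm by simp
  then show "\<exists>w. w^2 = 8 * t^2 + 1"
    by (metis of_int_eq_iff)
qed

theorem theorem2:
  fixes u v t :: int
  assumes "t > 0"
    and "(u - 1) * (v - 2) = 2 * t^2"
  shows "is_true u v \<longleftrightarrow>
    (\<exists>m::nat. m > 0 \<and>
      real_of_int t = ((3 + 2 * sqrt 2) ^ m - (3 - 2 * sqrt 2) ^ m) / (4 * sqrt 2))"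
proof -
  have "is_true u v \<longleftrightarrow> (\<exists>w. w^2 = 8 * t^2 + 1)"
    by (subst is_true_iff_discriminant_square) (simp_all add: assms(2) add.commute)
  then show ?thesis
    unfolding pell_solvable_iff_power[OF assms(1)] .
qed

end
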